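(* Let $G=(V_G,E_G)$ be a connected graph of order at least two, and let $I$ be a maximum independent set of $G$. Then $\gamma(G)=\beta(G)$ if and only if the following three conditions are all satisfied: (1) Each support vertex of $G$ belonging to $I$ is a weak support, and each of its non-leaf neighbors is a support vertex of $G$. (2) If $vu$ is an edge of the graph $G-I$, then both vertices $v$ and $u$ are support vertices of $G$. (3) If $x$ and $y$ are vertices belonging to $V_G-(I\cup L_G\cup S_G)$ and $d_G(x,y)=2$, then there are at least two (distinct) vertices $\overline{x}$ and $\overline{y}$ in $I$ such that $N_G(\overline{x})=N_G(\overline{y})=\{x,y\}$.
   Context: Graphs are finite, simple and undirected. $N_G(v)$ is the set of neighbors of $v$; $d_G$ is the graph distance. A leaf is a vertex of degree one; a support vertex (support) is a vertex adjacent to at least one leaf; a weak support is a vertex adjacent to exactly one leaf. $L_G$ and $S_G$ denote the sets of leaves and of support vertices of $G$, respectively (in $K_2$ both vertices are both leaves and supports). A set $D\subseteq V_G$ is dominating if every vertex in $V_G-D$ has a neighbor in $D$; $\gamma(G)$ is the minimum cardinality of a dominating set. A set $C\subseteq V_G$ is a covering set if every edge of $G$ has at least one end-vertex in $C$; $\beta(G)$ is the minimum cardinality of a covering set. *)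

theory Defs
  imports
    "Graph_Theory.Digraph_Component"
    "Graph_Theory.Shortest_Path"
begin

text \<open>
  A finite simple undirected graph is an instance of the locale \<^locale>\<open>graph\<close>: a finite symmetric
  digraph without loops and parallel arcs, in which every undirected edge is represented by
  a pair of opposite arcs. In particular the out-degree of a vertex is its degree.
\<close>

definition nbhd :: "('a, 'b) pre_digraph \<Rightarrow> 'a \<Rightarrow> 'a set" where
  "nbhd G v = {u \<in> verts G. v \<rightarrow>\<^bsub>G\<^esub> u}"

text \<open>
  The library's weighted distance with all arcs of weight one, that is, the least number of
  arcs of a walk; it is infinite if there is no walk.
\<close>
definition graph_dist :: "('a, 'b) pre_digraph \<Rightarrow> 'a \<Rightarrow> 'a \<Rightarrow> ereal" where
  "graph_dist G x y = wf_digraph.\<mu> G (\<lambda>_. 1) x y"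

definition leaves :: "('a, 'b) pre_digraph \<Rightarrow> 'a set" where
  "leaves G = {v \<in> verts G. out_degree G v = 1}"

definition supports :: "('a, 'b) pre_digraph \<Rightarrow> 'a set" where
  "supports G = {v \<in> verts G. \<exists>u \<in> leaves G. v \<rightarrow>\<^bsub>G\<^esub> u}"

definition weak_supports :: "('a, 'b) pre_digraph \<Rightarrow> 'a set" where
  "weak_supports G = {v \<in> verts G. \<exists>!u. u \<in> leaves G \<and> v \<rightarrow>\<^bsub>G\<^esub> u}"

definition dominating_set :: "('a, 'b) pre_digraph \<Rightarrow> 'a set \<Rightarrow> bool" where
  "dominating_set G D \<longleftrightarrow> D \<subseteq> verts G \<and> (\<forall>v \<in> verts G - D. \<exists>u \<in> D. v \<rightarrow>\<^bsub>G\<^esub> u)"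

definition domination_number :: "('a, 'b) pre_digraph \<Rightarrow> nat" where
  "domination_number G = Min {card D | D. dominating_set G D}"

definition covering_set :: "('a, 'b) pre_digraph \<Rightarrow> 'a set \<Rightarrow> bool" where
  "covering_set G C \<longleftrightarrow> C \<subseteq> verts G \<and> (\<forall>u v. u \<rightarrow>\<^bsub>G\<^esub> v \<longrightarrow> u \<in> C \<or> v \<in> C)"

definition covering_number :: "('a, 'b) pre_digraph \<Rightarrow> nat" where
  "covering_number G = Min {card C | C. covering_set G C}"

definition independent_set :: "('a, 'b) pre_digraph \<Rightarrow> 'a set \<Rightarrow> bool" where
  "independent_set G I \<longleftrightarrow> I \<subseteq> verts G \<and> (\<forall>u \<in> I. \<forall>v \<in> I. \<not> u \<rightarrow>\<^bsub>G\<^esub> v)"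

definition maximum_independent_set :: "('a, 'b) pre_digraph \<Rightarrow> 'a set \<Rightarrow> bool" where
  "maximum_independent_set G I \<longleftrightarrow>
     independent_set G I \<and> (\<forall>J. independent_set G J \<longrightarrow> card J \<le> card I)"

end

theory Submission
  imports Defs
begin

text \<open>
  Let \<open>C = verts G - I\<close>, a minimum covering set, which is also dominating. Conditions (1)--(3) say
  that no \<open>A \<subseteq> C\<close> with one or two elements can be exchanged for fewer vertices: after such an
  exchange the only vertices that may fail to be dominated are those of \<open>I\<close> whose neighbourhood lies
  in \<open>A\<close>. Conversely, let \<open>D\<close> be dominating. A support vertex in \<open>C - D\<close> has a leaf in \<open>D \<inter> I\<close>.
  Every other vertex \<open>c \<in> C - D\<close> has a neighbour in \<open>D \<inter> I\<close>; if that neighbour is shared with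
  another non-support vertex \<open>c' \<in> C - D\<close>, then (3) provides two vertices of \<open>D \<inter> I\<close> reserved for the
  pair \<open>{c, c'}\<close>. Hence \<open>card (C - D) \<le> card (D \<inter> I)\<close>.
\<close>

text \<open>The blocks cover \<open>X\<close> and may overlap, while the fibres of \<open>M\<close>
  over distinct blocks are disjoint in \<open>Z\<close>. Summing block sizes over the set of
  distinct blocks gives the bound.\<close>

lemma card_le_card_by_blocks:
  assumes "finite X" "finite Z"
    and blocks: "\<And>c. c \<in> X \<Longrightarrow> \<exists>e. finite e \<and> c \<in> e \<and> card e \<le> card {z \<in> Z. M z = e}"
  shows "card X \<le> card Z"
proof -
  obtain e where e: "\<And>c. c \<in> X \<Longrightarrow> finite (e c) \<and> c \<in> e c \<and> card (e c) \<le> card {z \<in> Z. M z = e c}"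
    using blocks by metis
  let ?E = "e ` X"
  have "card X \<le> card (\<Union>?E)"
    by (rule card_mono) (use assms(1) e in auto)
  also have "\<dots> \<le> (\<Sum>b\<in>?E. card b)"
    using e by (intro card_Union_le_sum_card)
  also have "\<dots> \<le> (\<Sum>b\<in>?E. card {z \<in> Z. M z = b})"
    using e by (intro sum_mono) auto
  also have "\<dots> = card (\<Union>b\<in>?E. {z \<in> Z. M z = b})"
    by (rule card_UN_disjoint[symmetric]) (use assms in auto)
  also have "\<dots> \<le> card Z"
    by (rule card_mono) (use assms in auto)
  finally show ?thesis .
qed

section \<open>Neighbourhoods, leaves and supports\<close>

context graph
begin

lemma dominates_sym: "u \<rightarrow> v \<Longrightarrow> v \<rightarrow> u"
  using arcs_ends_symmetric sym_arcs by metis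

lemma mem_nbhd_iff [simp]: "u \<in> nbhd G v \<longleftrightarrow> v \<rightarrow> u"
  by (auto simp: nbhd_def adj_in_verts)

lemma out_degree_eq_card_nbhd: "out_degree G v = card (nbhd G v)"
proof -
  have "nbhd G v = head G ` out_arcs G v"
    by (auto simp: set_eq_iff arcs_ends_conv)
  moreover have "inj_on (head G) (out_arcs G v)"
    by (auto intro!: inj_onI no_multi_arcs simp: arc_to_ends_def)
  ultimately show ?thesis
    by (simp add: out_degree_def card_image)
qed

lemma leaves_iff: "v \<in> leaves G \<longleftrightarrow> (\<exists>u. nbhd G v = {u})"
proof -
  have "v \<in> verts G" if "nbhd G v = {u}" for u
    using that adj_in_verts(1) mem_nbhd_iff by blast
  then show ?thesis
    by (auto simp: leaves_def out_degree_eq_card_nbhd card_1_singleton_iff)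
qed

text \<open>By symmetry, a leaf adjacent to \<open>v\<close> has \<open>v\<close> as its only
  neighbour. The exchange arguments produce supports in this form, by shrinking a neighbourhood to
  one point.\<close>

lemma supports_iff: "v \<in> supports G \<longleftrightarrow> (\<exists>u. nbhd G u = {v})"
proof
  assume "v \<in> supports G"
  then obtain u where "v \<rightarrow> u" "u \<in> leaves G"
    by (auto simp: supports_def)
  then show "\<exists>u. nbhd G u = {v}"
    by (metis leaves_iff dominates_sym mem_nbhd_iff singletonD)
next
  assume "\<exists>u. nbhd G u = {v}"
  then obtain u where u: "nbhd G u = {v}" ..
  then have "v \<rightarrow> u"
    using dominates_sym mem_nbhd_iff by blast
  then show "v \<in> supports G"
    using u by (auto simp: supports_def leaves_iff adj_in_verts)
qed

lemma dominates_induce_iff: "v \<rightarrow>\<^bsub>G \<restriction> S\<^esub> u \<longleftrightarrow> v \<rightarrow> u \<and> v \<in> S \<and> u \<in> S"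
  by (auto simp: arcs_ends_conv)

section \<open>Distance two\<close>

lemma graph_dist_eq_INF_length:
  "graph_dist G x y = (INF p\<in>{p. awalk x p y}. ereal (length p))"
proof -
  have "awalk_cost (\<lambda>_. 1) p = length p" for p
    by (induct p) auto
  then show ?thesis
    by (simp add: graph_dist_def \<mu>_def)
qed

lemma graph_dist_le_length: "awalk x p y \<Longrightarrow> graph_dist G x y \<le> ereal (length p)"
  unfolding graph_dist_eq_INF_length by (rule INF_lower) simp

text \<open>Reduces distance two to adjacency, so that walks need not be handled later: a walk of
  length two supplies the middle vertex, and the shorter lengths mean equality or adjacency.\<close>

lemma graph_dist_eq_2_iff:
  assumes "x \<in> verts G"
  shows "graph_dist G x y = 2 \<longleftrightarrow> x \<noteq> y \<and> \<not> x \<rightarrow> y \<and> (\<exists>z. x \<rightarrow> z \<and> z \<rightarrow> y)"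
proof
  assume dist: "graph_dist G x y = 2"
  have "x \<noteq> y"
  proof
    assume "x = y"
    then have "graph_dist G x y \<le> 0"
      using graph_dist_le_length[of x "[]" y] assms by (simp add: awalk_Nil_iff zero_ereal_def)
    then show False
      by (simp add: dist)
  qed
  moreover have "\<not> x \<rightarrow> y"
  proof
    assume "x \<rightarrow> y"
    then obtain a where "a \<in> arcs G" "tail G a = x" "head G a = y"
      by (rule reachableE)
    then have "graph_dist G x y \<le> 1"
      using graph_dist_le_length[of x "[a]" y] by (auto simp: awalk_simps one_ereal_def)
    then show False
      by (simp add: dist)
  qed
  moreover have "\<exists>z. x \<rightarrow> z \<and> z \<rightarrow> y"
  proof -
    \<comment> \<open>An infimum below 3 is undercut by an actual walk, so it need not be shown to
      be attained.\<close>
    have "graph_dist G x y < 3"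
      by (simp add: dist)
    then obtain p where p: "awalk x p y" "ereal (length p) < 3"
      unfolding graph_dist_eq_INF_length by (auto simp: INF_less_iff)
    then have "length p < 3"
      by (simp add: numeral_eq_ereal)
    then consider "p = []" | a where "p = [a]" | a b where "p = [a, b]"
      by (cases p; cases "tl p"; cases "tl (tl p)") auto
    then show ?thesis
    proof cases
      case 1
      with p \<open>x \<noteq> y\<close> show ?thesis
        by (simp add: awalk_Nil_iff)
    next
      case 2
      with p \<open>\<not> x \<rightarrow> y\<close> show ?thesis
        by (auto simp: awalk_simps in_arcs_imp_in_arcs_ends)
    next
      case 3
      with p have "a \<in> arcs G" "b \<in> arcs G" "tail G a = x" "head G a = tail G b" "head G b = y"
        by (auto simp: awalk_simps)
      then show ?thesis
        using in_arcs_imp_in_arcs_ends by metis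
    qed
  qed
  ultimately show "x \<noteq> y \<and> \<not> x \<rightarrow> y \<and> (\<exists>z. x \<rightarrow> z \<and> z \<rightarrow> y)"
    by blast
next
  assume "x \<noteq> y \<and> \<not> x \<rightarrow> y \<and> (\<exists>z. x \<rightarrow> z \<and> z \<rightarrow> y)"
  then obtain z where ne: "x \<noteq> y" and nadj: "\<not> x \<rightarrow> y" and z: "x \<rightarrow> z" "z \<rightarrow> y"
    by blast
  obtain a where a: "a \<in> arcs G" "tail G a = x" "head G a = z"
    using z(1) by (rule reachableE)
  obtain b where b: "b \<in> arcs G" "tail G b = z" "head G b = y"
    using z(2) by (rule reachableE)
  show "graph_dist G x y = 2"
  proof (rule antisym)
    show "graph_dist G x y \<le> 2"
      using graph_dist_le_length[of x "[a, b]" y] a b assms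
      by (auto simp: awalk_simps numeral_eq_ereal)
    show "2 \<le> graph_dist G x y"
      unfolding graph_dist_eq_INF_length
    proof (rule INF_greatest)
      fix p assume "p \<in> {p. awalk x p y}"
      then have p: "awalk x p y"
        by simp
      have "p \<noteq> []"
        using p ne by (auto simp: awalk_Nil_iff)
      moreover have "p \<noteq> [a]" for a
        using p nadj by (auto simp: awalk_simps dest: in_arcs_imp_in_arcs_ends)
      ultimately have "2 \<le> length p"
        by (cases p; cases "tl p") auto
      then show "2 \<le> ereal (length p)"
        by (simp add: numeral_eq_ereal)
    qed
  qed
qed

text \<open>A walk to a second vertex starts with an arc to a neighbour. Connectedness and the order
  enter the argument here, as the absence of isolated vertices.\<close>

lemma nbhd_nonempty:
  assumes "Digraph_Component.connected G" "card (verts G) \<ge> 2" "v \<in> verts G"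
  shows "nbhd G v \<noteq> {}"
proof -
  have "verts G \<noteq> {v}"
    using assms(2) by auto
  then obtain u where u: "u \<in> verts G" "u \<noteq> v"
    using assms(3) by blast
  have "v \<rightarrow>\<^sup>* u"
    using symmetric_connected_imp_strongly_connected[OF sym_arcs assms(1)] assms(3) u(1)
    by blast
  then show ?thesis
    by (rule converse_reachable_cases) (use u(2) mem_nbhd_iff in blast)+
qed

section \<open>Dominating sets and the domination number\<close>

lemma finite_dominating: "dominating_set G D \<Longrightarrow> finite D"
  by (auto simp: dominating_set_def intro: finite_subset)

lemma dominating_set_verts: "dominating_set G (verts G)"
  by (simp add: dominating_set_def)

lemma finite_dominating_cards: "finite {card D | D. dominating_set G D}"
  by (rule finite_subset[of _ "card ` Pow (verts G)"]) (auto simp: dominating_set_def)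

lemma le_domination_number_iff:
  "n \<le> domination_number G \<longleftrightarrow> (\<forall>D. dominating_set G D \<longrightarrow> n \<le> card D)"
  unfolding domination_number_def
  by (subst Min_ge_iff) (use finite_dominating_cards dominating_set_verts in auto)

end

section \<open>The cover complementary to a maximum independent set\<close>

locale graph_max_independent = graph +
  fixes I :: "'a set"
  assumes max_independent: "maximum_independent_set G I"
    and no_isolated: "v \<in> verts G \<Longrightarrow> nbhd G v \<noteq> {}"
begin

abbreviation "C \<equiv> verts G - I"

lemma independent: "independent_set G I"
  using max_independent by (simp add: maximum_independent_set_def)

lemma I_subset: "I \<subseteq> verts G"
  using independent by (simp add: independent_set_def)

lemma finite_I: "finite I"
  using I_subset finite_verts by (rule finite_subset)

lemma not_adjacent_I: "u \<in> I \<Longrightarrow> v \<in> I \<Longrightarrow> \<not> u \<rightarrow> v"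
  using independent by (simp add: independent_set_def)

lemma nbhd_I_subset: "u \<in> I \<Longrightarrow> nbhd G u \<subseteq> C"
  using not_adjacent_I adj_in_verts by auto

lemma card_independent_le: "independent_set G J \<Longrightarrow> card J \<le> card I"
  using max_independent by (simp add: maximum_independent_set_def)

lemma card_cover: "card C = card (verts G) - card I"
  by (simp add: card_Diff_subset finite_I I_subset)

text \<open>Gallai's complementation: the complement of a covering set is independent and
  conversely, so a largest independent set leaves a smallest cover.\<close>

lemma covering_number_eq: "covering_number G = card C"
  unfolding covering_number_def
proof (rule Min_eqI)
  show "finite {card B | B. covering_set G B}"
    by (rule finite_subset[of _ "card ` Pow (verts G)"]) (auto simp: covering_set_def)
  have "covering_set G C"
    using not_adjacent_I adj_in_verts by (auto simp: covering_set_def)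
  then show "card C \<in> {card B | B. covering_set G B}"
    by blast
next
  fix n assume "n \<in> {card B | B. covering_set G B}"
  then obtain B where B: "covering_set G B" "n = card B"
    by blast
  then have "B \<subseteq> verts G" "independent_set G (verts G - B)"
    by (auto simp: covering_set_def independent_set_def)
  then have "card (verts G) - card B \<le> card I"
    using card_independent_le[of "verts G - B"] finite_subset[OF _ finite_verts]
    by (simp add: card_Diff_subset)
  then show "card C \<le> n"
    using B(2) card_cover by simp
qed

text \<open>A vertex of \<open>I\<close> has some neighbour, which independence forces into
  \<open>C\<close>. Hence the domination number never exceeds the covering number.\<close>

lemma dominating_cover: "dominating_set G C"
proof -
  have "\<exists>u\<in>C. v \<rightarrow> u" if "v \<in> I" for v
    using nbhd_I_subset[OF that] no_isolated[of v] I_subset that by fastforce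
  then show ?thesis
    by (auto simp: dominating_set_def)
qed

lemma domination_eq_covering_iff:
  "domination_number G = covering_number G \<longleftrightarrow> (\<forall>D. dominating_set G D \<longrightarrow> card C \<le> card D)"
proof -
  have "domination_number G \<le> card C"
    using le_domination_number_iff[of "domination_number G"] dominating_cover by blast
  then show ?thesis
    using le_domination_number_iff[of "card C"] covering_number_eq by (metis order_antisym order_refl)
qed

text \<open>Replacing \<open>A\<close> by the smaller \<open>B\<close> in the cover leaves a set too
  small to dominate. An undominated vertex \<open>w\<close> is not in \<open>A\<close> by
  \<open>dom\<close>, hence lies in \<open>I\<close>; its neighbours are in \<open>C\<close> but
  avoid \<open>C - A\<close>.\<close>

lemma exchange:
  assumes min: "\<And>D. dominating_set G D \<Longrightarrow> card C \<le> card D"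
    and "A \<subseteq> C" "B \<subseteq> verts G" "card B < card A"
    and dom: "\<And>a. a \<in> A \<Longrightarrow> \<exists>b \<in> B \<union> (C - A). a \<rightarrow> b"
  obtains w where "w \<in> I - B" "nbhd G w \<subseteq> A"
proof -
  let ?D = "B \<union> (C - A)"
  have fin: "finite A" "finite B"
    using assms(2,3) finite_subset[OF _ finite_verts] by blast+
  have "card ?D \<le> card B + (card C - card A)"
    using card_Un_le[of B "C - A"] card_Diff_subset[OF fin(1) assms(2)] by simp
  also have "\<dots> < card C"
    using assms(4) card_mono[OF _ assms(2)] by simp
  finally have "\<not> dominating_set G ?D"
    using min[of ?D] by linarith
  then obtain w where w: "w \<in> verts G - ?D" "\<forall>u\<in>?D. \<not> w \<rightarrow> u"
    using assms(3) by (auto simp: dominating_set_def)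
  then have "w \<notin> A"
    using dom by blast
  then have "w \<in> I - B"
    using w(1) by blast
  moreover have "nbhd G w \<subseteq> A"
  proof
    fix u assume "u \<in> nbhd G w"
    then show "u \<in> A"
      using nbhd_I_subset[of w] w(2) calculation by auto
  qed
  ultimately show ?thesis
    using that by blast
qed

text \<open>If \<open>l\<close> were outside \<open>I\<close>, it could be added to
  \<open>I\<close>, because its only neighbour \<open>c\<close> is outside \<open>I\<close> too;
  this contradicts maximality.\<close>

lemma nbhd_eq_singleton_imp_I:
  assumes c: "c \<in> C" "nbhd G l = {c}"
    and edges: "\<And>v u. v \<rightarrow> u \<Longrightarrow> v \<in> C \<Longrightarrow> u \<in> C \<Longrightarrow> v \<in> supports G"
  shows "l \<in> I"
proof (rule ccontr)
  assume "l \<notin> I"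
  have lc: "l \<rightarrow> c" "c \<rightarrow> l"
    using c(2) dominates_sym mem_nbhd_iff by blast+
  then have "independent_set G (insert l I)"
  proof -
    have "\<not> l \<rightarrow> u" if "u \<in> insert l I" for u
      using that c \<open>l \<notin> I\<close> adj_not_same by (metis DiffE insertE mem_nbhd_iff singletonD)
    then show ?thesis
      using independent lc dominates_sym adj_in_verts(1) by (auto simp: independent_set_def)
  qed
  then show False
    using card_independent_le[of "insert l I"] finite_I \<open>l \<notin> I\<close> by simp
qed

text \<open>Trading \<open>s\<close> for two adjacent leaves would enlarge the independent set. This
  half of condition (1) thus follows from the maximality of \<open>I\<close> alone and serves both
  directions.\<close>

lemma support_in_I_weak:
  assumes "s \<in> supports G" "s \<in> I"
  shows "s \<in> weak_supports G"
proof -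
  obtain l where l: "nbhd G l = {s}"
    using assms(1) supports_iff by blast
  have leaf: "nbhd G k = {s}" if "k \<in> leaves G" "s \<rightarrow> k" for k
    using that dominates_sym by (metis leaves_iff mem_nbhd_iff singletonD)
  have "k = l" if k: "k \<in> leaves G" "s \<rightarrow> k" for k
  proof (rule ccontr)
    assume "k \<noteq> l"
    have nk: "nbhd G k = {s}"
      using leaf k .
    have sk: "s \<rightarrow> k" "s \<rightarrow> l"
      using k(2) l dominates_sym mem_nbhd_iff by blast+
    let ?J = "insert k (insert l (I - {s}))"
    have adj: "k \<rightarrow> u \<longleftrightarrow> u = s" "l \<rightarrow> u \<longleftrightarrow> u = s" for u
      using nk l mem_nbhd_iff by blast+
    have notin: "k \<notin> I" "l \<notin> I"
      using sk assms(2) not_adjacent_I by blast+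
    have "independent_set G ?J"
      unfolding independent_set_def
      using adj sk independent dominates_sym adj_in_verts adj_not_same not_adjacent_I I_subset
      by (smt (verit) insertE insert_subset Diff_iff singletonI subset_iff)
    then have "card ?J \<le> card I"
      by (rule card_independent_le)
    moreover have "card ?J = Suc (Suc (card (I - {s})))"
      using finite_I notin \<open>k \<noteq> l\<close> by simp
    moreover have "Suc (card (I - {s})) = card I"
      using finite_I assms(2) by (metis card_Suc_Diff1)
    ultimately show False
      by simp
  qed
  moreover have "l \<in> leaves G" "s \<rightarrow> l"
    using l leaves_iff dominates_sym mem_nbhd_iff by blast+
  ultimately show ?thesis
    using adj_in_verts by (auto simp: weak_supports_def)
qed

section \<open>Necessity of the conditions, by exchanges in the cover\<close>

context
  assumes min: "\<And>D. dominating_set G D \<Longrightarrow> card C \<le> card D"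
begin

text \<open>Exchange a leaf \<open>l\<close> at \<open>s\<close> together with \<open>u\<close> for
  \<open>s\<close>. The undominated vertex \<open>w\<close> differs from \<open>s\<close>, the only
  neighbour of \<open>l\<close>, so \<open>u\<close> is its only neighbour.\<close>

lemma nbr_of_support_in_I:
  assumes s: "s \<in> supports G" "s \<in> I" and u: "s \<rightarrow> u" "u \<notin> leaves G"
  shows "u \<in> supports G"
proof -
  obtain l where l: "nbhd G l = {s}"
    using s(1) supports_iff by blast
  then have sl: "l \<rightarrow> s" "s \<rightarrow> l"
    using dominates_sym mem_nbhd_iff by blast+
  have "l \<noteq> u"
    using l u(2) leaves_iff by blast
  moreover have "{l, u} \<subseteq> C"
    using nbhd_I_subset[OF s(2)] sl u(1) by auto
  moreover have "\<exists>b\<in>{s} \<union> (C - {l, u}). a \<rightarrow> b" if "a \<in> {l, u}" for a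
    using that sl u(1) dominates_sym by blast
  ultimately obtain w where w: "w \<in> I - {s}" "nbhd G w \<subseteq> {l, u}"
    using exchange[OF min, of "{l, u}" "{s}"] s(2) I_subset by auto
  have "\<not> w \<rightarrow> l"
    using w(1) l dominates_sym mem_nbhd_iff by blast
  then have "nbhd G w = {u}"
    using w no_isolated[of w] I_subset by fastforce
  then show ?thesis
    using supports_iff by blast
qed

text \<open>Drop \<open>v\<close> without replacement: \<open>u\<close> still dominates it, so the
  undominated vertex is a leaf at \<open>v\<close>.\<close>

lemma adjacent_in_cover_support:
  assumes "v \<rightarrow> u" "v \<in> C" "u \<in> C"
  shows "v \<in> supports G"
proof -
  have "u \<noteq> v"
    using assms(1) adj_not_same by blast
  then obtain w where w: "w \<in> I" "nbhd G w \<subseteq> {v}"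
    using exchange[OF min, of "{v}" "{}"] assms by auto
  then have "nbhd G w = {v}"
    using no_isolated[of w] I_subset by blast
  then show ?thesis
    using supports_iff by blast
qed

text \<open>Exchange \<open>x\<close> and \<open>y\<close> for \<open>z\<close>. The undominated
  vertex has both as neighbours, since a single one would be a support.\<close>

lemma twin_exists:
  assumes "x \<in> C - supports G" "y \<in> C - supports G" "x \<noteq> y" "z \<in> I" "x \<rightarrow> z" "z \<rightarrow> y"
  shows "\<exists>w\<in>I - {z}. nbhd G w = {x, y}"
proof -
  have "\<exists>b\<in>{z} \<union> (C - {x, y}). a \<rightarrow> b" if "a \<in> {x, y}" for a
    using that assms dominates_sym by blast
  then obtain w where w: "w \<in> I - {z}" "nbhd G w \<subseteq> {x, y}"
    using exchange[OF min, of "{x, y}" "{z}"] assms I_subset by auto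
  have "nbhd G w \<noteq> {x}" "nbhd G w \<noteq> {y}" "nbhd G w \<noteq> {}"
    using assms supports_iff no_isolated[of w] w(1) I_subset by blast+
  then have "nbhd G w = {x, y}"
    using w(2) by blast
  then show ?thesis
    using w(1) by blast
qed

text \<open>The exchange is done twice: the middle vertex \<open>z\<close> may have further
  neighbours, so it only yields the first twin \<open>w\<close>, which then replaces
  \<open>z\<close> and yields the second.\<close>

lemma twins_exist:
  assumes x: "x \<in> C - supports G" and y: "y \<in> C - supports G"
    and dist: "graph_dist G x y = 2"
  shows "\<exists>x'\<in>I. \<exists>y'\<in>I. x' \<noteq> y' \<and> nbhd G x' = {x, y} \<and> nbhd G y' = {x, y}"
proof -
  obtain z where xy: "x \<noteq> y" "x \<rightarrow> z" "z \<rightarrow> y"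
    using dist graph_dist_eq_2_iff x by blast
  \<comment> \<open>Otherwise the edge from \<open>x\<close> to \<open>z\<close> would lie inside
    the cover and make \<open>x\<close> a support.\<close>
  then have "z \<in> I"
    using adjacent_in_cover_support[of x z] adj_in_verts x by blast
  then obtain w where w: "w \<in> I" "nbhd G w = {x, y}"
    using twin_exists[OF x y] xy by blast
  then have "x \<rightarrow> w" "w \<rightarrow> y"
    using dominates_sym mem_nbhd_iff by blast+
  then obtain w' where "w' \<in> I - {w}" "nbhd G w' = {x, y}"
    using twin_exists[OF x y xy(1) w(1)] by blast
  then show ?thesis
    using w by blast
qed

end

section \<open>Sufficiency of the conditions, by counting blocks\<close>

lemma card_cover_le_dominating:
  assumes supp: "\<And>s u. s \<in> supports G \<Longrightarrow> s \<in> I \<Longrightarrow> s \<rightarrow> u \<Longrightarrow> u \<notin> leaves G \<Longrightarrow> u \<in> supports G"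
    and edges: "\<And>v u. v \<rightarrow> u \<Longrightarrow> v \<in> C \<Longrightarrow> u \<in> C \<Longrightarrow> v \<in> supports G"
    and twins: "\<And>x y. x \<in> C - leaves G - supports G \<Longrightarrow> y \<in> C - leaves G - supports G \<Longrightarrow>
      graph_dist G x y = 2 \<Longrightarrow>
      \<exists>x'\<in>I. \<exists>y'\<in>I. x' \<noteq> y' \<and> nbhd G x' = {x, y} \<and> nbhd G y' = {x, y}"
    and D: "dominating_set G D"
  shows "card C \<le> card D"
proof -
  \<comment> \<open>Outside the common part of \<open>C\<close> and \<open>D\<close>, the vertices
    of \<open>X\<close> have to be paid for by those of \<open>Z\<close>.\<close>
  define X where "X = C - D"
  define Y where "Y = X - supports G"
  define Z where "Z = D \<inter> I"
  \<comment> \<open>\<open>M z\<close> is the block that \<open>z\<close> helps to pay for.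
    Restricting to \<open>Y\<close> discards neighbours that are supports or lie in
    \<open>D\<close>; the first case lets a leaf pay for its support.\<close>
  define M where "M z = (if nbhd G z \<inter> Y = {} then nbhd G z else nbhd G z \<inter> Y)" for z
  have fin: "finite D" "finite X" "finite Z"
    using finite_dominating[OF D] by (auto simp: X_def Z_def)
  have nbr_in_D: "\<exists>u\<in>D. v \<rightarrow> u" if "v \<in> verts G" "v \<notin> D" for v
    using D that by (auto simp: dominating_set_def)
  have one: "\<exists>e. finite e \<and> c \<in> e \<and> card e \<le> card {z \<in> Z. M z = e}" if "z \<in> Z" "M z = {c}" for c z
  proof -
    have "{z} \<subseteq> {z \<in> Z. M z = {c}}"
      using that by auto
    then have "card {z} \<le> card {z \<in> Z. M z = {c}}"
      using fin(3) by (intro card_mono) auto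
    then show ?thesis
      by (intro exI[of _ "{c}"]) simp
  qed
  have "card X \<le> card Z"
  proof (rule card_le_card_by_blocks[OF fin(2,3)])
    fix c assume c: "c \<in> X"
    show "\<exists>e. finite e \<and> c \<in> e \<and> card e \<le> card {z \<in> Z. M z = e}"
    proof (cases "c \<in> supports G")
      case True
      then obtain l where l: "nbhd G l = {c}"
        using supports_iff by blast
      then have "l \<in> I"
        using nbhd_eq_singleton_imp_I[OF _ l edges] c by (simp add: X_def)
      moreover have "l \<in> D"
        using nbr_in_D[of l] c l I_subset \<open>l \<in> I\<close> by (auto simp: X_def simp flip: mem_nbhd_iff)
      moreover have "M l = {c}"
        using l True by (simp add: M_def Y_def)
      ultimately show ?thesis
        using one[of l c] by (simp add: Z_def)
    next
      case False
      then have "c \<in> Y"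
        using c by (simp add: Y_def)
      obtain z where z: "z \<in> D" "c \<rightarrow> z"
        using nbr_in_D[of c] c by (auto simp: X_def)
      \<comment> \<open>Otherwise condition (2), applied to the edge between \<open>c\<close> and
        \<open>z\<close>, would make \<open>c\<close> a support.\<close>
      then have zI: "z \<in> I"
        using edges[of c z] c False adj_in_verts by (auto simp: X_def)
      have cz: "c \<in> nbhd G z \<inter> Y"
        using z(2) \<open>c \<in> Y\<close> dominates_sym by simp
      show ?thesis
      proof (cases "nbhd G z \<inter> Y = {c}")
        case True
        then show ?thesis
          using one[of z c] z zI by (simp add: M_def Z_def)
      next
        case False
        then obtain d where d: "z \<rightarrow> d" "d \<in> Y" "d \<noteq> c"
          using cz by fastforce
        have CY: "c \<in> C - supports G" "d \<in> C - supports G" "c \<notin> D" "d \<notin> D"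
          using \<open>c \<in> Y\<close> d(2) by (auto simp: X_def Y_def)
        \<comment> \<open>If \<open>z\<close> were a support, condition (1) would make its
          non-support neighbours \<open>c\<close> and \<open>d\<close> two leaves at a weak
          support.\<close>
        have "z \<notin> supports G"
        proof
          assume "z \<in> supports G"
          then have "z \<in> weak_supports G" "c \<in> leaves G" "d \<in> leaves G"
            using support_in_I_weak zI supp[of z] CY d(1) z(2) dominates_sym by blast+
          then show False
            using d(1,3) z(2) dominates_sym by (auto simp: weak_supports_def)
        qed
        \<comment> \<open>A leaf among them would have \<open>z\<close> as its only neighbour and
          make \<open>z\<close> a support.\<close>
        then have "c \<notin> leaves G" "d \<notin> leaves G"
          using z(2) d(1) dominates_sym leaves_iff supports_iff mem_nbhd_iff
          by (metis singletonD)+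
        moreover have "\<not> c \<rightarrow> d"
          using edges[of c d] CY by blast
        then have "graph_dist G c d = 2"
          using graph_dist_eq_2_iff[of c d] CY d z(2) by blast
        ultimately obtain x' y' where xy: "x' \<in> I" "y' \<in> I" "x' \<noteq> y'"
            "nbhd G x' = {c, d}" "nbhd G y' = {c, d}"
          using twins[of c d] CY by blast
        \<comment> \<open>Both neighbours of \<open>w\<close> are missing from \<open>D\<close>, so
          \<open>w\<close> must belong to \<open>D\<close> itself; the two twins then pay for the
          block of size two.\<close>
        have twin: "w \<in> Z \<and> M w = {c, d}" if "w \<in> I" "nbhd G w = {c, d}" for w
        proof -
          have "w \<in> D"
            using nbr_in_D[of w] that I_subset CY by (auto simp flip: mem_nbhd_iff)
          then show ?thesis
            using that \<open>c \<in> Y\<close> d(2) by (simp add: M_def Z_def)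
        qed
        then have "{x', y'} \<subseteq> {z \<in> Z. M z = {c, d}}"
          using xy by blast
        then have "card {x', y'} \<le> card {z \<in> Z. M z = {c, d}}"
          using fin(3) by (intro card_mono) auto
        then show ?thesis
          using xy(3) d(3) by (intro exI[of _ "{c, d}"]) simp
      qed
    qed
  qed
  moreover have "card C = card (C \<inter> D) + card X"
    unfolding X_def by (rule card_Int_Diff) simp
  moreover have "card D = card (D \<inter> C) + card Z"
  proof -
    have "D - C = Z"
      using D by (auto simp: Z_def dominating_set_def)
    then show ?thesis
      using card_Int_Diff[OF fin(1), of C] by simp
  qed
  ultimately show ?thesis
    by (simp add: Int_commute)
qed

end

section \<open>Equality of the domination and covering numbers\<close>

theorem theorem2:
  fixes G :: "('a, 'b) pre_digraph" and I :: "'a set"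
  assumes "graph G"
    and "Digraph_Component.connected G"
    and "card (verts G) \<ge> 2"
    and "maximum_independent_set G I"
  shows "domination_number G = covering_number G \<longleftrightarrow>
    (\<forall>s \<in> supports G \<inter> I.
        s \<in> weak_supports G \<and> (\<forall>u \<in> nbhd G s - leaves G. u \<in> supports G)) \<and>
    (\<forall>v u. v \<rightarrow>\<^bsub>G \<restriction> (verts G - I)\<^esub> u \<longrightarrow> v \<in> supports G \<and> u \<in> supports G) \<and>
    (\<forall>x \<in> verts G - (I \<union> leaves G \<union> supports G).
      \<forall>y \<in> verts G - (I \<union> leaves G \<union> supports G).
        graph_dist G x y = 2 \<longrightarrow>
        (\<exists>x' \<in> I. \<exists>y' \<in> I. x' \<noteq> y' \<and> nbhd G x' = {x, y} \<and> nbhd G y' = {x, y}))"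
  (is "_ \<longleftrightarrow> ?supp \<and> ?edges \<and> ?twins")
proof -
  interpret graph G
    by (rule assms(1))
  interpret graph_max_independent G I
    by unfold_locales (use assms(4) nbhd_nonempty[OF assms(2,3)] in auto)
  show ?thesis
    unfolding domination_eq_covering_iff
  proof (intro iffI)
    assume "\<forall>D. dominating_set G D \<longrightarrow> card C \<le> card D"
    then have min: "\<And>D. dominating_set G D \<Longrightarrow> card C \<le> card D"
      by blast
    have ?supp
      using support_in_I_weak nbr_of_support_in_I[OF min] by auto
    moreover have ?edges
      using adjacent_in_cover_support[OF min] dominates_sym by (simp add: dominates_induce_iff) blast
    moreover have ?twins
      using twins_exist[OF min] by simp
    ultimately show "?supp \<and> ?edges \<and> ?twins"
      by blast
  next
    assume "?supp \<and> ?edges \<and> ?twins"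
    then have supp: ?supp and edges: ?edges and twins: ?twins
      by blast+
    show "\<forall>D. dominating_set G D \<longrightarrow> card C \<le> card D"
    proof (intro allI impI, rule card_cover_le_dominating)
      show "u \<in> supports G" if "s \<in> supports G" "s \<in> I" "s \<rightarrow>\<^bsub>G\<^esub> u" "u \<notin> leaves G" for s u
        using supp that by simp
      show "v \<in> supports G" if "v \<rightarrow>\<^bsub>G\<^esub> u" "v \<in> C" "u \<in> C" for v u
        using edges that by (simp add: dominates_induce_iff)
      show "\<exists>x'\<in>I. \<exists>y'\<in>I. x' \<noteq> y' \<and> nbhd G x' = {x, y} \<and> nbhd G y' = {x, y}"
        if "x \<in> C - leaves G - supports G" "y \<in> C - leaves G - supports G" "graph_dist G x y = 2"
        for x y
        using twins that by simp
    qed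
  qed
qed

end
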